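(* Let $d_1,\dots,d_n$ be a sequence of possibly dependent, square-integrable real random variables, and let $e_1,\dots,e_n$ be a decoupled sequence of $d_1,\dots,d_n$ (with respect to an increasing sequence of $\sigma$-algebras $\{\mathcal{F}_i\}_{0\le i\le n}$ and given a $\sigma$-algebra $\mathcal{G}$). Then $$\mathbb{E}\left(\sum_{i=1}^n d_i\right)^2\le 2\,\mathbb{E}\left(\sum_{i=1}^n e_i\right)^2-\left[\mathbb{E}\left(\sum_{i=1}^n e_i\right)\right]^2 .$$
   Context: All random variables are defined on a probability space $(\Omega,\mathcal{F},\mathbb{P})$ and are square-integrable. $\mathbb{E}(X)^2$ means $\mathbb{E}[X^2]$, whereas $[\mathbb{E}(X)]^2$ is the square of the expectation. $\mathcal{L}(X\mid\mathcal{H})$ denotes the conditional law of $X$ given a $\sigma$-algebra $\mathcal{H}$. Let $\mathcal{F}_0\subseteq\mathcal{F}_1\subseteq\dots\subseteq\mathcal{F}_n\subseteq\mathcal{F}$ be $\sigma$-algebras and let $\{d_i\}_{1\le i\le n}$, $\{e_i\}_{1\le i\le n}$ be sequences adapted to $\{\mathcal{F}_i\}$ (i.e. $d_i,e_i$ are $\mathcal{F}_i$-measurable). (Tangent) $\{d_i\}$ is tangent to $\{e_i\}$ with respect to $\{\mathcal{F}_i\}$ if $\mathcal{L}(d_i\mid\mathcal{F}_{i-1})=\mathcal{L}(e_i\mid\mathcal{F}_{i-1})$ for all $i$. (Conditionally independent, CI) $\{e_i\}$ is CI if there is a $\sigma$-algebra $\mathcal{G}\subseteq\mathcal{F}$ such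 that $e_1,\dots,e_n$ are conditionally independent given $\mathcal{G}$ and $\mathcal{L}(e_i\mid\mathcal{F}_{i-1})=\mathcal{L}(e_i\mid\mathcal{G})$ for all $i$. (Decoupled) $\{e_i\}$ is a decoupled sequence (decoupled version) of $\{d_i\}$, given $\mathcal{G}$, if $\{e_i\}$ is CI with this $\mathcal{G}$ and is tangent to $\{d_i\}$ with respect to $\{\mathcal{F}_i\}$. *)

theory Defs
  imports "HOL-Probability.Probability"
begin

text \<open>
  A sub-\<open>\<sigma>\<close>-algebra of the probability space \<open>M\<close> is represented, as in
  \<^theory>\<open>HOL-Probability.Conditional_Expectation\<close>, by a measure \<open>H\<close> with \<open>subalgebra M H\<close>;
  only its space and its measurable sets matter.
\<close>

definition cond_law ::
  "'w measure \<Rightarrow> 'w measure \<Rightarrow> ('w \<Rightarrow> real) \<Rightarrow> real set \<Rightarrow> 'w \<Rightarrow> real"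
  where "cond_law M H X A = real_cond_exp M H (indicator (X -` A \<inter> space M))"

text \<open>
  Equality of conditional laws holds up to almost sure equality.  Since \<open>real_cond_exp\<close> picks
  an arbitrary version of \<open>P(X \<in> A | H)\<close> separately for each Borel set \<open>A\<close>, the exceptional
  null set is allowed to depend on \<open>A\<close>.
\<close>

definition same_cond_law ::
  "'w measure \<Rightarrow> ('w \<Rightarrow> real) \<Rightarrow> 'w measure \<Rightarrow> ('w \<Rightarrow> real) \<Rightarrow> 'w measure \<Rightarrow> bool"
  where "same_cond_law M X H Y K \<longleftrightarrow>
    (\<forall>A\<in>sets borel. AE \<omega> in M. cond_law M H X A \<omega> = cond_law M K Y A \<omega>)"

definition cond_indep_vars ::
  "'w measure \<Rightarrow> 'w measure \<Rightarrow> ('i \<Rightarrow> 'w \<Rightarrow> real) \<Rightarrow> 'i set \<Rightarrow> bool"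
  where "cond_indep_vars M G X I \<longleftrightarrow>
    (\<forall>i\<in>I. X i \<in> borel_measurable M) \<and>
    (\<forall>J\<subseteq>I. J \<noteq> {} \<longrightarrow> finite J \<longrightarrow> (\<forall>A\<in>J \<rightarrow> sets borel. AE \<omega> in M.
       real_cond_exp M G (indicator (\<Inter>j\<in>J. X j -` A j \<inter> space M)) \<omega>
         = (\<Prod>j\<in>J. cond_law M G (X j) (A j) \<omega>)))"

definition tangent ::
  "'w measure \<Rightarrow> (nat \<Rightarrow> 'w measure) \<Rightarrow> nat \<Rightarrow> (nat \<Rightarrow> 'w \<Rightarrow> real) \<Rightarrow> (nat \<Rightarrow> 'w \<Rightarrow> real) \<Rightarrow> bool"
  where "tangent M F n d e \<longleftrightarrow>
    (\<forall>i\<in>{1..n}. same_cond_law M (d i) (F (i - 1)) (e i) (F (i - 1)))"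

definition CI_given ::
  "'w measure \<Rightarrow> (nat \<Rightarrow> 'w measure) \<Rightarrow> 'w measure \<Rightarrow> nat \<Rightarrow> (nat \<Rightarrow> 'w \<Rightarrow> real) \<Rightarrow> bool"
  where "CI_given M F G n e \<longleftrightarrow>
    subalgebra M G \<and> cond_indep_vars M G e {1..n} \<and>
    (\<forall>i\<in>{1..n}. same_cond_law M (e i) (F (i - 1)) (e i) G)"

definition decoupled ::
  "'w measure \<Rightarrow> (nat \<Rightarrow> 'w measure) \<Rightarrow> 'w measure \<Rightarrow> nat
    \<Rightarrow> (nat \<Rightarrow> 'w \<Rightarrow> real) \<Rightarrow> (nat \<Rightarrow> 'w \<Rightarrow> real) \<Rightarrow> bool"
  where "decoupled M F G n d e \<longleftrightarrow> CI_given M F G n e \<and> tangent M F n d e"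

end

theory Submission imports Defs
begin

text \<open>
  Let \<open>v\<^sub>i = E(d\<^sub>i | F\<^sub>i\<^sub>-\<^sub>1)\<close>, which is almost surely \<open>w\<^sub>i = E(e\<^sub>i | G)\<close>, and put
  \<open>A = \<Sum>(d\<^sub>i - v\<^sub>i)\<close>, \<open>B = \<Sum>(e\<^sub>i - w\<^sub>i)\<close>, \<open>V = \<Sum>v\<^sub>i = \<Sum>w\<^sub>i\<close>.  The summands of \<open>A\<close> are orthogonal
  as martingale differences, those of \<open>B\<close> by conditional independence, and corresponding
  summands have the same second moment; hence \<open>E A\<^sup>2 = E B\<^sup>2\<close>.  Moreover \<open>B\<close> is orthogonal to \<open>V\<close>,
  so \<open>E(B + V)\<^sup>2 = E B\<^sup>2 + E V\<^sup>2\<close>.  The claim follows from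
  \<open>(A + V)\<^sup>2 = 2 A\<^sup>2 + 2 V\<^sup>2 - (A - V)\<^sup>2\<close> and \<open>E(A - V)\<^sup>2 \<ge> (E(A - V))\<^sup>2 = (E V)\<^sup>2\<close>.
\<close>

section \<open>Square-integrable functions and orthogonality\<close>

text \<open>Measurability is a separate condition because integrability of the square does not imply
  it.\<close>

definition square_integrable :: "'a measure \<Rightarrow> ('a \<Rightarrow> real) set"
  where "square_integrable M = {f \<in> borel_measurable M. integrable M (\<lambda>x. (f x)\<^sup>2)}"

lemma square_integrable_measurable [measurable_dest]:
  "f \<in> square_integrable M \<Longrightarrow> f \<in> borel_measurable M"
  by (simp add: square_integrable_def)

lemma integrable_mult_square_integrable:
  assumes "f \<in> square_integrable M" "g \<in> square_integrable M"
  shows "integrable M (\<lambda>x. f x * g x)"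
proof (rule Bochner_Integration.integrable_bound)
  show "integrable M (\<lambda>x. (f x)\<^sup>2 + (g x)\<^sup>2)"
    using assms by (simp add: square_integrable_def)
  show "(\<lambda>x. f x * g x) \<in> borel_measurable M"
    using assms by (auto simp: square_integrable_def)
  have "\<bar>a * b\<bar> \<le> a\<^sup>2 + b\<^sup>2" for a b :: real
    using sum_squares_bound[of "\<bar>a\<bar>" "\<bar>b\<bar>"] mult_nonneg_nonneg[of "\<bar>a\<bar>" "\<bar>b\<bar>"]
    unfolding abs_mult power2_abs by linarith
  then show "AE x in M. norm (f x * g x) \<le> norm ((f x)\<^sup>2 + (g x)\<^sup>2)"
    by simp
qed

lemma square_integrable_add:
  assumes "f \<in> square_integrable M" "g \<in> square_integrable M"
  shows "(\<lambda>x. f x + g x) \<in> square_integrable M"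
  using assms integrable_mult_square_integrable[OF assms]
  by (auto simp: square_integrable_def power2_sum mult.assoc)

lemma square_integrable_diff:
  assumes "f \<in> square_integrable M" "g \<in> square_integrable M"
  shows "(\<lambda>x. f x - g x) \<in> square_integrable M"
  using assms integrable_mult_square_integrable[OF assms]
  by (auto simp: square_integrable_def power2_diff mult.assoc)

lemma square_integrable_sum:
  "(\<And>i. i \<in> I \<Longrightarrow> f i \<in> square_integrable M) \<Longrightarrow> (\<lambda>x. \<Sum>i\<in>I. f i x) \<in> square_integrable M"
  \<comment> \<open>The empty sum and a sum over an infinite set are both the zero function, whose
    membership is the instance at \<open>\<lambda>_. 0\<close>.\<close>
  by (induction I rule: infinite_finite_induct)
    (auto intro: square_integrable_add simp: square_integrable_def[where M=M, THEN eqset_imp_iff, of "\<lambda>_. 0"])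

text \<open>Pythagoras: the square expands into a double sum, of which only the diagonal
  survives.\<close>

lemma integral_square_sum_orthogonal:
  assumes "finite I" "\<And>i. i \<in> I \<Longrightarrow> f i \<in> square_integrable M"
    and "\<And>i j. i \<in> I \<Longrightarrow> j \<in> I \<Longrightarrow> i \<noteq> j \<Longrightarrow> (\<integral>x. f i x * f j x \<partial>M) = 0"
  shows "(\<integral>x. (\<Sum>i\<in>I. f i x)\<^sup>2 \<partial>M) = (\<Sum>i\<in>I. \<integral>x. (f i x)\<^sup>2 \<partial>M)"
proof -
  have "(\<integral>x. (\<Sum>i\<in>I. f i x)\<^sup>2 \<partial>M) = (\<Sum>i\<in>I. \<Sum>j\<in>I. \<integral>x. f i x * f j x \<partial>M)"
    using assms(2) by (simp add: power2_eq_square sum_product Bochner_Integration.integral_sum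
        integrable_mult_square_integrable)
  also have "\<dots> = (\<Sum>i\<in>I. \<Sum>j\<in>I. if i = j then \<integral>x. (f i x)\<^sup>2 \<partial>M else 0)"
    using assms(3) by (intro sum.cong refl) (auto simp: power2_eq_square)
  finally show ?thesis
    using assms(1) by simp
qed

section \<open>Equality of integrals from equality on events\<close>

text \<open>
  No integrability of \<open>h \<circ> X\<close> is needed: both sides are the integral of \<open>h\<close> against the common law
  of \<open>X\<close> and \<open>Y\<close> under the measures with densities \<open>f\<close> and \<open>g\<close>.
\<close>

lemma integral_density_transfer:
  fixes f g X Y :: "'a \<Rightarrow> real" and h :: "real \<Rightarrow> real"
  assumes f: "integrable M f" "AE x in M. 0 \<le> f x" and g: "integrable M g" "AE x in M. 0 \<le> g x"
    and [measurable]: "X \<in> borel_measurable M" "Y \<in> borel_measurable M" "h \<in> borel_measurable borel"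
    and eq: "\<And>A. A \<in> sets borel \<Longrightarrow>
      (\<integral>x. f x * indicator (X -` A \<inter> space M) x \<partial>M) = (\<integral>x. g x * indicator (Y -` A \<inter> space M) x \<partial>M)"
  shows "(\<integral>x. f x * h (X x) \<partial>M) = (\<integral>x. g x * h (Y x) \<partial>M)"
proof -
  have [measurable]: "f \<in> borel_measurable M" "g \<in> borel_measurable M"
    using f g by auto
  have em: "emeasure (distr (density M u) borel Z) A
      = ennreal (\<integral>x. u x * indicator (Z -` A \<inter> space M) x \<partial>M)"
    if u: "integrable M u" "AE x in M. 0 \<le> u x" and [measurable]: "Z \<in> borel_measurable M"
      and [measurable]: "A \<in> sets borel" for u Z :: "'a \<Rightarrow> real" and A
  proof -
    have [measurable]: "u \<in> borel_measurable M"
      using u by auto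
    have "emeasure (distr (density M u) borel Z) A
        = (\<integral>\<^sup>+x. ennreal (u x) * indicator (Z -` A \<inter> space M) x \<partial>M)"
      by (simp add: emeasure_distr emeasure_density)
    also have "\<dots> = (\<integral>\<^sup>+x. ennreal (u x * indicator (Z -` A \<inter> space M) x) \<partial>M)"
      by (intro nn_integral_cong) (auto simp: indicator_def)
    also have "\<dots> = ennreal (\<integral>x. u x * indicator (Z -` A \<inter> space M) x \<partial>M)"
      using u by (intro nn_integral_eq_integral integrable_real_mult_indicator) auto
    finally show ?thesis .
  qed
  have "distr (density M f) borel X = distr (density M g) borel Y"
    by (rule measure_eqI) (simp_all add: em f g eq)
  then have "(\<integral>y. h y \<partial>distr (density M f) borel X) = (\<integral>y. h y \<partial>distr (density M g) borel Y)"
    by simp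
  then show ?thesis
    using f g by (simp add: integral_distr integral_density)
qed

section \<open>Conditional expectation of square-integrable functions\<close>

context prob_space
begin

lemma sigma_finite_subalgebra: "subalgebra M H \<Longrightarrow> sigma_finite_subalgebra M H"
  by (intro finite_measure_subalgebra_is_sigma_finite) unfold_locales

lemma integrable_square_integrable: "f \<in> square_integrable M \<Longrightarrow> integrable M f"
  by (auto simp: square_integrable_def intro: square_integrable_imp_integrable)

text \<open>Conditional Jensen inequality for the convex function \<open>y\<^sup>2\<close>.\<close>

lemma square_integrable_real_cond_exp:
  assumes H: "subalgebra M H" and f: "f \<in> square_integrable M"
  shows "real_cond_exp M H f \<in> square_integrable M"
proof -
  interpret H: sigma_finite_subalgebra M H
    using H by (rule sigma_finite_subalgebra)
  have "integrable M (\<lambda>x. (real_cond_exp M H f x)\<^sup>2)"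
    using f integrable_square_integrable[OF f]
    by (intro H.integrable_convex_cond_exp[where I=UNIV]) (auto simp: square_integrable_def convex_power2)
  then show ?thesis
    by (simp add: square_integrable_def)
qed

text \<open>Uniqueness of conditional expectation, applied to \<open>M\<close> as a subalgebra of
  itself: there \<open>f\<close> is its own conditional expectation, and \<open>g\<close> has the
  same defining integrals.\<close>

lemma AE_eq_if_set_integrals_eq:
  fixes f g :: "'a \<Rightarrow> real"
  assumes "integrable M f" "integrable M g"
    and "\<And>C. C \<in> sets M \<Longrightarrow> (\<integral>x\<in>C. f x \<partial>M) = (\<integral>x\<in>C. g x \<partial>M)"
  shows "AE x in M. f x = g x"
proof -
  interpret S: sigma_finite_subalgebra M M
    by (rule sigma_finite_subalgebra) (simp add: subalgebra_def)
  have "AE x in M. real_cond_exp M M f x = g x"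
    using assms by (intro S.real_cond_exp_charact) auto
  moreover have "AE x in M. real_cond_exp M M f x = f x"
    using assms by (intro S.real_cond_exp_F_meas) auto
  ultimately show ?thesis
    by auto
qed

text \<open>The factor \<open>real_cond_exp M H f\<close> is measurable with respect to
  \<open>H\<close>, so it can be taken out when \<open>g\<close> is conditioned on
  \<open>H\<close>.\<close>

lemma integral_real_cond_exp_swap:
  assumes H: "subalgebra M H" and f: "f \<in> square_integrable M" and g: "g \<in> square_integrable M"
  shows "(\<integral>x. real_cond_exp M H f x * g x \<partial>M) = (\<integral>x. real_cond_exp M H f x * real_cond_exp M H g x \<partial>M)"
proof -
  interpret H: sigma_finite_subalgebra M H
    using H by (rule sigma_finite_subalgebra)
  show ?thesis
    using g by (intro H.real_cond_exp_intg(2)[symmetric] integrable_mult_square_integrable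
        square_integrable_real_cond_exp H f) (auto simp: square_integrable_def)
qed

lemma square_integrable_indicator:
  "C \<in> sets M \<Longrightarrow> indicator C \<in> square_integrable M"
  by (simp add: square_integrable_def power2_eq_square less_top[symmetric] flip: indicator_inter_arith)

text \<open>Conditional expectation is self-adjoint: both sides equal the integral of the product of
  the two conditional expectations.\<close>

lemma integral_real_cond_exp_symmetric:
  assumes "subalgebra M H" "f \<in> square_integrable M" "g \<in> square_integrable M"
  shows "(\<integral>x. real_cond_exp M H f x * g x \<partial>M) = (\<integral>x. f x * real_cond_exp M H g x \<partial>M)"
  using integral_real_cond_exp_swap[OF assms] integral_real_cond_exp_swap[OF assms(1,3,2)]
  by (simp add: mult.commute)

lemma real_cond_exp_indicator_nonneg:
  assumes "subalgebra M H" and [measurable]: "C \<in> sets M"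
  shows "AE x in M. 0 \<le> real_cond_exp M H (indicator C) x"
proof -
  interpret H: sigma_finite_subalgebra M H
    using assms(1) by (rule sigma_finite_subalgebra)
  show ?thesis
    by (intro H.real_cond_exp_pos) auto
qed

section \<open>Consequences of equal conditional laws\<close>

text \<open>
  Testing against an event \<open>C\<close> and moving the conditional expectation onto its indicator replaces
  the two conditional laws by the laws of \<open>X\<close> and \<open>Y\<close> under densities \<open>P(C | H)\<close> and \<open>P(C | K)\<close>;
  this avoids choosing regular versions of the conditional laws.
\<close>

lemma same_cond_law_cond_exp_eq:
  assumes H: "subalgebra M H" and K: "subalgebra M K"
    and X: "X \<in> square_integrable M" and Y: "Y \<in> square_integrable M"
    and law: "same_cond_law M X H Y K"
  shows "AE x in M. real_cond_exp M H X x = real_cond_exp M K Y x"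
proof (rule AE_eq_if_set_integrals_eq)
  note cond_exp = square_integrable_real_cond_exp[OF H X] square_integrable_real_cond_exp[OF K Y]
  show "integrable M (real_cond_exp M H X)" "integrable M (real_cond_exp M K Y)"
    using cond_exp by (auto intro: integrable_square_integrable)
  note [measurable] = square_integrable_measurable[OF X] square_integrable_measurable[OF Y]
  fix C assume C[measurable]: "C \<in> sets M"
  let ?a = "real_cond_exp M H (indicator C)" and ?b = "real_cond_exp M K (indicator C)"
  have C2: "indicator C \<in> square_integrable M"
    using C by (rule square_integrable_indicator)
  have "(\<integral>x. ?a x * X x \<partial>M) = (\<integral>x. ?b x * Y x \<partial>M)"
  proof (rule integral_density_transfer[where h="\<lambda>y. y"])
    show "integrable M ?a" "integrable M ?b"
      using C2 by (auto intro: integrable_square_integrable square_integrable_real_cond_exp H K)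
    show "AE x in M. 0 \<le> ?a x" "AE x in M. 0 \<le> ?b x"
      using H K C by (auto intro: real_cond_exp_indicator_nonneg)
    fix A :: "real set" assume A[measurable]: "A \<in> sets borel"
    let ?X = "indicator (X -` A \<inter> space M) :: 'a \<Rightarrow> real"
      and ?Y = "indicator (Y -` A \<inter> space M) :: 'a \<Rightarrow> real"
    have XY: "?X \<in> square_integrable M" "?Y \<in> square_integrable M"
      by (auto intro!: square_integrable_indicator)
    have "(\<integral>x. ?a x * ?X x \<partial>M) = (\<integral>x. indicator C x * real_cond_exp M H ?X x \<partial>M)"
      by (rule integral_real_cond_exp_symmetric[OF H C2 XY(1)])
    also have "\<dots> = (\<integral>x. indicator C x * real_cond_exp M K ?Y x \<partial>M)"
    proof (rule integral_cong_AE)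
      have "AE x in M. real_cond_exp M H ?X x = real_cond_exp M K ?Y x"
        using law A by (simp add: same_cond_law_def cond_law_def)
      then show "AE x in M. indicator C x * real_cond_exp M H ?X x
          = indicator C x * real_cond_exp M K ?Y x"
        by eventually_elim simp
    qed simp_all
    also have "\<dots> = (\<integral>x. ?b x * ?Y x \<partial>M)"
      by (rule integral_real_cond_exp_symmetric[OF K C2 XY(2), symmetric])
    finally show "(\<integral>x. ?a x * ?X x \<partial>M) = (\<integral>x. ?b x * ?Y x \<partial>M)" .
  qed simp_all
  then show "(\<integral>x\<in>C. real_cond_exp M H X x \<partial>M) = (\<integral>x\<in>C. real_cond_exp M K Y x \<partial>M)"
    using integral_real_cond_exp_symmetric[OF H C2 X] integral_real_cond_exp_symmetric[OF K C2 Y]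
    by (simp add: set_lebesgue_integral_def)
qed

text \<open>Integrating the conditional probabilities of an event removes the conditioning, so
  \<open>X\<close> and \<open>Y\<close> have the same law. Both densities in the transfer are
  therefore the constant 1. With \<open>h\<close> the square, this equates the second moments of
  tangent variables.\<close>

lemma same_cond_law_integral_eq:
  fixes h :: "real \<Rightarrow> real"
  assumes H: "subalgebra M H" and K: "subalgebra M K"
    and [measurable]: "X \<in> borel_measurable M" "Y \<in> borel_measurable M" "h \<in> borel_measurable borel"
    and law: "same_cond_law M X H Y K"
  shows "(\<integral>x. h (X x) \<partial>M) = (\<integral>x. h (Y x) \<partial>M)"
proof -
  interpret H: sigma_finite_subalgebra M H
    using H by (rule sigma_finite_subalgebra)
  interpret K: sigma_finite_subalgebra M K
    using K by (rule sigma_finite_subalgebra)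
  have "(\<integral>x. 1 * h (X x) \<partial>M) = (\<integral>x. 1 * h (Y x) \<partial>M)"
  proof (rule integral_density_transfer[where f="\<lambda>_. 1" and g="\<lambda>_. 1" and h=h])
    fix A :: "real set" assume A[measurable]: "A \<in> sets borel"
    let ?X = "indicator (X -` A \<inter> space M) :: 'a \<Rightarrow> real"
      and ?Y = "indicator (Y -` A \<inter> space M) :: 'a \<Rightarrow> real"
    have "integrable M ?X" "integrable M ?Y"
      by (auto intro!: integrable_square_integrable square_integrable_indicator)
    moreover have "(\<integral>x. real_cond_exp M H ?X x \<partial>M) = (\<integral>x. real_cond_exp M K ?Y x \<partial>M)"
      using law A by (intro integral_cong_AE) (simp_all add: same_cond_law_def cond_law_def)
    ultimately show "(\<integral>x. 1 * ?X x \<partial>M) = (\<integral>x. 1 * ?Y x \<partial>M)"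
      using H.real_cond_exp_int(2)[of ?X] K.real_cond_exp_int(2)[of ?Y] by simp
  qed simp_all
  then show ?thesis
    by simp
qed

section \<open>Product moments under conditional independence\<close>

lemma integral_mult_eq_0:
  fixes X Z :: "'a \<Rightarrow> real"
  assumes X: "X \<in> square_integrable M" and Z: "Z \<in> square_integrable M"
    and eq: "\<And>A. A \<in> sets borel \<Longrightarrow> (\<integral>x. indicator (X -` A \<inter> space M) x * Z x \<partial>M) = 0"
  shows "(\<integral>x. X x * Z x \<partial>M) = 0"
proof -
  define H where "H = vimage_algebra (space M) X borel"
  have sets_H: "sets H = {X -` A \<inter> space M |A. A \<in> sets borel}"
    unfolding H_def by (rule sets_vimage_algebra2) simp
  have H: "subalgebra M H"
    using square_integrable_measurable[OF X]
    by (auto simp: subalgebra_def sets_H) (auto simp: H_def)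
  have XH: "X \<in> borel_measurable H"
    unfolding H_def by (rule measurable_vimage_algebra1) simp
  interpret H: sigma_finite_subalgebra M H
    using H by (rule sigma_finite_subalgebra)
  have "AE x in M. real_cond_exp M H Z x = 0"
    using Z integrable_square_integrable[OF Z] eq
    by (intro H.real_cond_exp_charact) (auto simp: sets_H set_lebesgue_integral_def)
  then have "(\<integral>x. X x * real_cond_exp M H Z x \<partial>M) = (\<integral>x. 0 \<partial>M)"
    using square_integrable_measurable[OF X] by (intro integral_cong_AE) auto
  moreover have "(\<integral>x. X x * real_cond_exp M H Z x \<partial>M) = (\<integral>x. X x * Z x \<partial>M)"
    using Z by (intro H.real_cond_exp_intg(2) XH integrable_mult_square_integrable X)
      (auto simp: square_integrable_def)
  ultimately show ?thesis
    by simp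
qed

text \<open>Conditional independence speaks of events only, so it is extended to functions one
  factor at a time: first to \<open>X j\<close> with an event of \<open>X i\<close> fixed, then to
  \<open>X i\<close> itself.\<close>

lemma cond_indep_vars_integral_mult:
  assumes G: "subalgebra M G" and CI: "cond_indep_vars M G X I"
    and ij: "i \<in> I" "j \<in> I" "i \<noteq> j"
    and Xi: "X i \<in> square_integrable M" and Xj: "X j \<in> square_integrable M"
  shows "(\<integral>x. X i x * X j x \<partial>M) = (\<integral>x. real_cond_exp M G (X i) x * real_cond_exp M G (X j) x \<partial>M)"
proof -
  interpret G: sigma_finite_subalgebra M G
    using G by (rule sigma_finite_subalgebra)
  note [measurable] = square_integrable_measurable[OF Xi] square_integrable_measurable[OF Xj]
  let ?E = "real_cond_exp M G"
  have Ej: "?E (X j) \<in> square_integrable M"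
    by (rule square_integrable_real_cond_exp[OF G Xj])
  have ind: "(\<integral>x. indicator (X i -` A \<inter> space M) x * X j x \<partial>M)
      = (\<integral>x. indicator (X i -` A \<inter> space M) x * ?E (X j) x \<partial>M)"
    if A[measurable]: "A \<in> sets borel" for A
  proof -
    let ?f = "indicator (X i -` A \<inter> space M) :: 'a \<Rightarrow> real"
    have f: "?f \<in> square_integrable M"
      by (auto intro!: square_integrable_indicator)
    \<comment> \<open>The indicator of the event of \<open>X i\<close> and its conditional
      probability given \<open>G\<close> serve as densities; conditional independence says that
      \<open>X j\<close> has the same law under both.\<close>
    have "(\<integral>x. ?f x * X j x \<partial>M) = (\<integral>x. ?E ?f x * X j x \<partial>M)"
    proof (rule integral_density_transfer[where h="\<lambda>y. y"])
      show "integrable M ?f" "integrable M (?E ?f)"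
        using f by (auto intro!: integrable_square_integrable square_integrable_real_cond_exp G)
      show "AE x in M. 0 \<le> ?f x" "AE x in M. 0 \<le> ?E ?f x"
        by (auto intro!: real_cond_exp_indicator_nonneg G)
      fix B :: "real set" assume B[measurable]: "B \<in> sets borel"
      let ?g = "indicator (X j -` B \<inter> space M) :: 'a \<Rightarrow> real"
        and ?fg = "indicator ((X i -` A \<inter> space M) \<inter> (X j -` B \<inter> space M)) :: 'a \<Rightarrow> real"
      \<comment> \<open>One family of Borel sets covering both indices; it is consistent because
        \<open>i\<close> and \<open>j\<close> differ.\<close>
      let ?A = "\<lambda>k. if k = i then A else B"
      have "(\<Inter>k\<in>{i, j}. X k -` ?A k \<inter> space M) = (X i -` A \<inter> space M) \<inter> (X j -` B \<inter> space M)"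
        using ij by auto
      moreover have "AE x in M. ?E (indicator (\<Inter>k\<in>{i, j}. X k -` ?A k \<inter> space M)) x
          = (\<Prod>k\<in>{i, j}. cond_law M G (X k) (?A k) x)"
        using CI ij A B unfolding cond_indep_vars_def
        by (elim conjE allE[of _ "{i, j}"] impE ballE[of _ _ ?A]) auto
      ultimately have ae: "AE x in M. ?E ?fg x = ?E ?f x * ?E ?g x"
        using ij by (simp add: cond_law_def)
      have "(\<integral>x. ?f x * ?g x \<partial>M) = (\<integral>x. ?fg x \<partial>M)"
        by (simp add: indicator_inter_arith)
      also have "\<dots> = (\<integral>x. ?E ?fg x \<partial>M)"
        by (intro G.real_cond_exp_int(2)[symmetric] integrable_square_integrable
            square_integrable_indicator) auto
      also have "\<dots> = (\<integral>x. ?E ?f x * ?E ?g x \<partial>M)"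
        using ae by (intro integral_cong_AE) auto
      also have "\<dots> = (\<integral>x. ?E ?f x * ?g x \<partial>M)"
        by (intro integral_real_cond_exp_swap[symmetric] G f square_integrable_indicator) auto
      finally show "(\<integral>x. ?f x * ?g x \<partial>M) = (\<integral>x. ?E ?f x * ?g x \<partial>M)" .
    qed simp_all
    then show ?thesis
      using integral_real_cond_exp_symmetric[OF G f Xj] by simp
  qed
  have diff: "(\<integral>x. f x * (X j x - ?E (X j) x) \<partial>M) = (\<integral>x. f x * X j x \<partial>M) - (\<integral>x. f x * ?E (X j) x \<partial>M)"
    if "f \<in> square_integrable M" for f
    unfolding right_diff_distrib
    by (intro Bochner_Integration.integral_diff integrable_mult_square_integrable that Xj Ej)
  \<comment> \<open>By \<open>ind\<close>, the residual of \<open>X j\<close> given \<open>G\<close>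
    integrates to zero over every event of \<open>X i\<close>.\<close>
  have "(\<integral>x. X i x * (X j x - ?E (X j) x) \<partial>M) = 0"
  proof (rule integral_mult_eq_0[OF Xi square_integrable_diff[OF Xj Ej]])
    fix A :: "real set" assume A[measurable]: "A \<in> sets borel"
    have "X i -` A \<inter> space M \<in> sets M"
      by measurable
    from diff[OF square_integrable_indicator[OF this]] ind[OF A]
    show "(\<integral>x. indicator (X i -` A \<inter> space M) x * (X j x - ?E (X j) x) \<partial>M) = 0"
      by simp
  qed
  then have "(\<integral>x. X i x * X j x \<partial>M) = (\<integral>x. X i x * ?E (X j) x \<partial>M)"
    using diff[OF Xi] by simp
  also have "\<dots> = (\<integral>x. ?E (X i) x * ?E (X j) x \<partial>M)"
    using integral_real_cond_exp_swap[OF G Xj Xi] by (simp add: mult.commute)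
  finally show ?thesis .
qed

section \<open>Conditional expectation as orthogonal projection\<close>

lemma integral_mult_real_cond_exp_diff:
  assumes H: "subalgebra M H" and f: "f \<in> borel_measurable H" "f \<in> square_integrable M"
    and g: "g \<in> square_integrable M"
  shows "(\<integral>x. f x * (g x - real_cond_exp M H g x) \<partial>M) = 0"
proof -
  interpret H: sigma_finite_subalgebra M H
    using H by (rule sigma_finite_subalgebra)
  have "(\<integral>x. f x * real_cond_exp M H g x \<partial>M) = (\<integral>x. f x * g x \<partial>M)"
    using f g by (intro H.real_cond_exp_intg(2) integrable_mult_square_integrable)
      (auto simp: square_integrable_def)
  then show ?thesis
    using f g by (simp add: right_diff_distrib integrable_mult_square_integrable
        square_integrable_real_cond_exp H)
qed

text \<open>Pythagoras for a projection and its residual. It allows residuals taken with respect to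
  different \<sigma>-algebras to be compared through second moments alone.\<close>

lemma integral_square_real_cond_exp_diff:
  assumes H: "subalgebra M H" and f: "f \<in> square_integrable M"
  shows "(\<integral>x. (f x - real_cond_exp M H f x)\<^sup>2 \<partial>M) = (\<integral>x. (f x)\<^sup>2 \<partial>M) - (\<integral>x. (real_cond_exp M H f x)\<^sup>2 \<partial>M)"
proof -
  let ?E = "real_cond_exp M H f"
  note E = square_integrable_real_cond_exp[OF H f]
  have "(\<integral>x. (f x - ?E x)\<^sup>2 \<partial>M) = (\<integral>x. (f x)\<^sup>2 - (?E x)\<^sup>2 - 2 * (?E x * (f x - ?E x)) \<partial>M)"
    by (simp add: power2_eq_square algebra_simps)
  also have "\<dots> = (\<integral>x. (f x)\<^sup>2 \<partial>M) - (\<integral>x. (?E x)\<^sup>2 \<partial>M) - 2 * (\<integral>x. ?E x * (f x - ?E x) \<partial>M)"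
    using f E integrable_mult_square_integrable[OF E square_integrable_diff[OF f E]]
    by (simp add: square_integrable_def)
  also have "(\<integral>x. ?E x * (f x - ?E x) \<partial>M) = 0"
    using E by (intro integral_mult_real_cond_exp_diff H f) auto
  finally show ?thesis
    by simp
qed

section \<open>The inequality for sums of residuals and projections\<close>

text \<open>The cross term of \<open>A\<close> and \<open>V\<close> is not controlled, so it is
  eliminated by the parallelogram law; that of \<open>B\<close> and \<open>W\<close> vanishes by
  \<open>BW\<close>. The functions \<open>V\<close> and \<open>W\<close> are kept apart since they
  agree only almost surely.\<close>

lemma second_moment_sum_le:
  assumes A: "A \<in> square_integrable M" and B: "B \<in> square_integrable M"
    and V: "V \<in> square_integrable M" and W: "W \<in> square_integrable M"
    and VW: "AE x in M. V x = W x"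
    and EA: "expectation A = 0" and EB: "expectation B = 0"
    and AB: "(\<integral>x. (A x)\<^sup>2 \<partial>M) = (\<integral>x. (B x)\<^sup>2 \<partial>M)"
    and BW: "(\<integral>x. B x * W x \<partial>M) = 0"
  shows "(\<integral>x. (A x + V x)\<^sup>2 \<partial>M) \<le> 2 * (\<integral>x. (B x + W x)\<^sup>2 \<partial>M) - (expectation (\<lambda>x. B x + W x))\<^sup>2"
proof -
  note [simp] = integrable_square_integrable[OF A] integrable_square_integrable[OF B]
    integrable_square_integrable[OF V] integrable_square_integrable[OF W]
  have sq: "integrable M (\<lambda>x. (f x)\<^sup>2)" if "f \<in> square_integrable M" for f
    using that by (simp add: square_integrable_def)
  note D = square_integrable_diff[OF A V]
  note [simp] = sq[OF A] sq[OF B] sq[OF V] sq[OF W] sq[OF D] integrable_mult_square_integrable[OF B W]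
  have "expectation V = expectation W"
    using VW V W by (intro integral_cong_AE) auto
  moreover have "(\<integral>x. (V x)\<^sup>2 \<partial>M) = (\<integral>x. (W x)\<^sup>2 \<partial>M)"
    using VW V W by (intro integral_cong_AE) auto
  moreover have "(\<integral>x. (A x + V x)\<^sup>2 \<partial>M) = (\<integral>x. 2 * (A x)\<^sup>2 + 2 * (V x)\<^sup>2 - (A x - V x)\<^sup>2 \<partial>M)"
    by (simp add: power2_eq_square algebra_simps)
  moreover have "\<dots> = 2 * (\<integral>x. (A x)\<^sup>2 \<partial>M) + 2 * (\<integral>x. (V x)\<^sup>2 \<partial>M) - (\<integral>x. (A x - V x)\<^sup>2 \<partial>M)"
    by simp
  \<comment> \<open>The variance of \<open>A - V\<close> is nonnegative, and its mean is minus that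
    of \<open>V\<close> by \<open>EA\<close>.\<close>
  moreover have "(expectation V)\<^sup>2 \<le> (\<integral>x. (A x - V x)\<^sup>2 \<partial>M)"
    using variance_eq[of "\<lambda>x. A x - V x"] variance_positive[of "\<lambda>x. A x - V x"] EA by simp
  moreover have "(\<integral>x. (B x + W x)\<^sup>2 \<partial>M) = (\<integral>x. (B x)\<^sup>2 \<partial>M) + (\<integral>x. (W x)\<^sup>2 \<partial>M)"
    using BW by (simp add: power2_sum mult.assoc)
  ultimately show ?thesis
    using EB AB by simp
qed

end

section \<open>Decoupling of the second moment\<close>

theorem theorem3p4:
  fixes M :: "'w measure" and F :: "nat \<Rightarrow> 'w measure" and G :: "'w measure"
    and n :: nat and d e :: "nat \<Rightarrow> 'w \<Rightarrow> real"
  assumes "prob_space M"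
    and "\<And>i. i \<le> n \<Longrightarrow> subalgebra M (F i)"
    and "\<And>i j. i \<le> j \<Longrightarrow> j \<le> n \<Longrightarrow> subalgebra (F j) (F i)"
    and "\<And>i. i \<in> {1..n} \<Longrightarrow> d i \<in> borel_measurable (F i)"
    and "\<And>i. i \<in> {1..n} \<Longrightarrow> e i \<in> borel_measurable (F i)"
    and "\<And>i. i \<in> {1..n} \<Longrightarrow> integrable M (\<lambda>\<omega>. (d i \<omega>)\<^sup>2)"
    and "\<And>i. i \<in> {1..n} \<Longrightarrow> integrable M (\<lambda>\<omega>. (e i \<omega>)\<^sup>2)"
    and "decoupled M F G n d e"
  shows "prob_space.expectation M (\<lambda>\<omega>. (\<Sum>i=1..n. d i \<omega>)\<^sup>2)
    \<le> 2 * prob_space.expectation M (\<lambda>\<omega>. (\<Sum>i=1..n. e i \<omega>)\<^sup>2)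
      - (prob_space.expectation M (\<lambda>\<omega>. \<Sum>i=1..n. e i \<omega>))\<^sup>2"
proof -
  interpret prob_space M by fact
  note One_nat_def [simp del]
  define I where "I = {1..n}"
  have F: "subalgebra M (F (i - 1))" if "i \<in> I" for i
    using that by (intro assms(2)) (auto simp: I_def)
  have d: "d i \<in> square_integrable M" and e: "e i \<in> square_integrable M" if "i \<in> I" for i
  proof -
    have i: "i \<in> {1..n}" and Fi: "subalgebra M (F i)"
      using that assms(2) by (simp_all add: I_def)
    show "d i \<in> square_integrable M" "e i \<in> square_integrable M"
      using measurable_from_subalg[OF Fi assms(4)[OF i]] measurable_from_subalg[OF Fi assms(5)[OF i]]
        assms(6,7)[OF i] by (simp_all add: square_integrable_def)
  qed
  have G: "subalgebra M G" and CI: "cond_indep_vars M G e I"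
    and ee: "\<And>i. i \<in> I \<Longrightarrow> same_cond_law M (e i) (F (i - 1)) (e i) G"
    and de: "\<And>i. i \<in> I \<Longrightarrow> same_cond_law M (d i) (F (i - 1)) (e i) (F (i - 1))"
    using assms(8) by (simp_all add: decoupled_def CI_given_def tangent_def I_def)
  define v where "v i = real_cond_exp M (F (i - 1)) (d i)" for i
  define w where "w i = real_cond_exp M G (e i)" for i
  have v: "v i \<in> square_integrable M" and w: "w i \<in> square_integrable M" if "i \<in> I" for i
    unfolding v_def w_def using that by (simp_all add: square_integrable_real_cond_exp F G d e)
  \<comment> \<open>The link is the conditional expectation of \<open>e i\<close> given
    \<open>F (i - 1)\<close>: tangency identifies it with \<open>v i\<close>, the CI property with
    \<open>w i\<close>.\<close>
  have vw: "AE x in M. v i x = w i x" if "i \<in> I" for i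
    using same_cond_law_cond_exp_eq[OF F F d e de, OF that that that that that]
      same_cond_law_cond_exp_eq[OF F G e e ee, OF that that that that]
    unfolding v_def w_def by eventually_elim simp
  let ?a = "\<lambda>i x. d i x - v i x" and ?b = "\<lambda>i x. e i x - w i x"
  have a: "?a i \<in> square_integrable M" and b: "?b i \<in> square_integrable M" if "i \<in> I" for i
    using that by (auto intro!: square_integrable_diff d e v w)
  have const: "(\<lambda>_. 1) \<in> square_integrable M"
    by (simp add: square_integrable_def)
  have a_mean: "expectation (?a i) = 0" and b_mean: "expectation (?b i) = 0" if "i \<in> I" for i
    unfolding v_def w_def
    using integral_mult_real_cond_exp_diff[OF F[OF that] borel_measurable_const const d[OF that]]
      integral_mult_real_cond_exp_diff[OF G borel_measurable_const const e[OF that]]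
    by (simp_all only: mult_1)
  have a_less: "(\<integral>x. ?a i x * ?a j x \<partial>M) = 0" if "i \<in> I" "j \<in> I" "i < j" for i j
  proof -
    \<comment> \<open>Since \<open>i < j\<close> gives \<open>i \<le> j - 1\<close>, both
      \<open>d i\<close> and \<open>v i\<close> are already measurable for \<open>F (j - 1)\<close>,
      to which the residual of \<open>d j\<close> is orthogonal.\<close>
    have le: "i \<le> j - 1" "i - 1 \<le> j - 1" "j - 1 \<le> n" "i \<in> {1..n}"
      using that by (auto simp: I_def)
    have "d i \<in> borel_measurable (F (j - 1))"
      by (rule measurable_from_subalg[OF assms(3)[OF le(1,3)] assms(4)[OF le(4)]])
    moreover have "v i \<in> borel_measurable (F (j - 1))"
      unfolding v_def
      by (rule measurable_from_subalg[OF assms(3)[OF le(2,3)] borel_measurable_cond_exp])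
    ultimately have "?a i \<in> borel_measurable (F (j - 1))"
      by (rule borel_measurable_diff)
    from integral_mult_real_cond_exp_diff[OF F[OF that(2)] this a[OF that(1)] d[OF that(2)]]
    show ?thesis
      unfolding v_def[of j] .
  qed
  have a_orth: "(\<integral>x. ?a i x * ?a j x \<partial>M) = 0" if "i \<in> I" "j \<in> I" "i \<noteq> j" for i j
  proof (cases "i < j")
    case False
    then have "j < i"
      using that by simp
    from a_less[OF that(2,1) this] show ?thesis
      by (simp only: mult.commute)
  qed (use that a_less in blast)
  \<comment> \<open>Each \<open>w j\<close> is measurable for \<open>G\<close> and each
    \<open>?b i\<close> is a residual given \<open>G\<close>, so this covers \<open>i = j\<close>
    too.\<close>
  have bw: "(\<integral>x. ?b i x * w j x \<partial>M) = 0" if "i \<in> I" "j \<in> I" for i j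
    using integral_mult_real_cond_exp_diff[OF G borel_measurable_cond_exp w[OF that(2), unfolded w_def]
        e[OF that(1)]]
    unfolding w_def by (simp only: mult.commute)
  have b_orth: "(\<integral>x. ?b i x * ?b j x \<partial>M) = 0" if "i \<in> I" "j \<in> I" "i \<noteq> j" for i j
  proof -
    have "(\<integral>x. ?b i x * ?b j x \<partial>M) = (\<integral>x. ?b i x * e j x \<partial>M) - (\<integral>x. ?b i x * w j x \<partial>M)"
      unfolding right_diff_distrib
      by (intro Bochner_Integration.integral_diff integrable_mult_square_integrable b e w that)
    also have "\<dots> = (\<integral>x. ?b i x * e j x \<partial>M)"
      using bw[OF that(1,2)] by simp
    also have "\<dots> = (\<integral>x. e i x * e j x \<partial>M) - (\<integral>x. w i x * e j x \<partial>M)"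
      unfolding left_diff_distrib
      by (intro Bochner_Integration.integral_diff integrable_mult_square_integrable e w that)
    \<comment> \<open>Both integrals equal that of \<open>w i * w j\<close>: the first by
      conditional independence, the second by conditioning \<open>e j\<close> on
      \<open>G\<close>.\<close>
    also have "\<dots> = 0"
      unfolding w_def
      using cond_indep_vars_integral_mult[OF G CI that e[OF that(1)] e[OF that(2)]]
        integral_real_cond_exp_swap[OF G e[OF that(1)] e[OF that(2)]] by (simp only: diff_self)
    finally show ?thesis .
  qed
  \<comment> \<open>The two residuals are taken given \<open>F (i - 1)\<close> and \<open>G\<close>
    respectively; their second moments agree because those of the variables and of the projections
    do.\<close>
  have ab: "(\<integral>x. (?a i x)\<^sup>2 \<partial>M) = (\<integral>x. (?b i x)\<^sup>2 \<partial>M)" if i: "i \<in> I" for i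
  proof -
    have "(\<integral>x. (d i x)\<^sup>2 \<partial>M) = (\<integral>x. (e i x)\<^sup>2 \<partial>M)"
      by (rule same_cond_law_integral_eq[where h="\<lambda>y. y\<^sup>2", OF F[OF i] F[OF i] _ _ _ de[OF i]])
        (use square_integrable_measurable[OF d[OF i]] square_integrable_measurable[OF e[OF i]] in simp_all)
    moreover have "(\<integral>x. (v i x)\<^sup>2 \<partial>M) = (\<integral>x. (w i x)\<^sup>2 \<partial>M)"
      using vw[OF i] square_integrable_measurable[OF v[OF i]] square_integrable_measurable[OF w[OF i]]
      by (intro integral_cong_AE) auto
    ultimately show ?thesis
      using integral_square_real_cond_exp_diff[OF F[OF i] d[OF i]]
        integral_square_real_cond_exp_diff[OF G e[OF i]]
      unfolding v_def w_def by (simp only:)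
  qed
  let ?A = "\<lambda>x. \<Sum>i\<in>I. ?a i x" and ?B = "\<lambda>x. \<Sum>i\<in>I. ?b i x"
    and ?V = "\<lambda>x. \<Sum>i\<in>I. v i x" and ?W = "\<lambda>x. \<Sum>i\<in>I. w i x"
  have "(\<integral>x. (?A x + ?V x)\<^sup>2 \<partial>M) \<le> 2 * (\<integral>x. (?B x + ?W x)\<^sup>2 \<partial>M) - (expectation (\<lambda>x. ?B x + ?W x))\<^sup>2"
  proof (rule second_moment_sum_le)
    have fin: "finite I"
      by (simp add: I_def)
    show "?A \<in> square_integrable M" "?B \<in> square_integrable M"
      "?V \<in> square_integrable M" "?W \<in> square_integrable M"
      by (intro square_integrable_sum a b v w; assumption)+
    have "AE x in M. \<forall>i\<in>I. v i x = w i x"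
      using vw fin by (simp add: AE_finite_all)
    then show "AE x in M. ?V x = ?W x"
      by eventually_elim simp
    have "expectation ?A = (\<Sum>i\<in>I. expectation (?a i))"
      by (intro Bochner_Integration.integral_sum integrable_square_integrable a)
    then show "expectation ?A = 0"
      by (simp only: a_mean sum.neutral_const cong: sum.cong)
    have "expectation ?B = (\<Sum>i\<in>I. expectation (?b i))"
      by (intro Bochner_Integration.integral_sum integrable_square_integrable b)
    then show "expectation ?B = 0"
      by (simp only: b_mean sum.neutral_const cong: sum.cong)
    have "(\<integral>x. (?A x)\<^sup>2 \<partial>M) = (\<Sum>i\<in>I. \<integral>x. (?a i x)\<^sup>2 \<partial>M)"
      by (rule integral_square_sum_orthogonal[OF fin a a_orth])
    also have "\<dots> = (\<Sum>i\<in>I. \<integral>x. (?b i x)\<^sup>2 \<partial>M)"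
      by (intro sum.cong refl ab)
    also have "\<dots> = (\<integral>x. (?B x)\<^sup>2 \<partial>M)"
      by (rule integral_square_sum_orthogonal[OF fin b b_orth, symmetric])
    finally show "(\<integral>x. (?A x)\<^sup>2 \<partial>M) = (\<integral>x. (?B x)\<^sup>2 \<partial>M)" .
    have "(\<integral>x. ?B x * ?W x \<partial>M) = (\<Sum>i\<in>I. \<Sum>j\<in>I. \<integral>x. ?b i x * w j x \<partial>M)"
      unfolding sum_product
      by (subst Bochner_Integration.integral_sum;
          intro sum.cong refl Bochner_Integration.integral_sum Bochner_Integration.integrable_sum
            integrable_mult_square_integrable b w)
    also have "\<dots> = 0"
      by (simp only: bw sum.neutral_const cong: sum.cong)
    finally show "(\<integral>x. ?B x * ?W x \<partial>M) = 0" .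
  qed
  \<comment> \<open>The projections cancel pointwise, which restores the original sums.\<close>
  moreover have "?A x + ?V x = (\<Sum>i=1..n. d i x)" "?B x + ?W x = (\<Sum>i=1..n. e i x)" for x
    by (simp_all add: I_def flip: sum.distrib)
  ultimately show ?thesis
    by (simp only:)
qed

end
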